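(* Let $P_t=(P,\circ_{t\lambda},[\cdot_\lambda\cdot]_t)$ and $P'_t=(P,\circ'_{t\lambda},[\cdot_\lambda\cdot]'_t)$ be two linear deformations of a noncommutative Poisson conformal algebra $P$, generated by $(\varpi,\omega)$ and $(\varpi',\omega')$ respectively. If $P_t$ and $P'_t$ are equivalent, then $\omega+\varpi$ and $\omega'+\varpi'$ are in the same cohomology class in $H^2_{\mathrm{FGV}}(P,P)$.
   Context: All vector spaces are over $\mathbb{C}$. In expressions such as $b_{-\lambda-\partial}a$ the variable is replaced by $-\lambda-\partial$ with $\partial$ moved to the left, acting on the coefficients. A conformal algebra is a $\mathbb{C}[\partial]$-module $A$ with a bilinear map $A\times A\to A[\lambda]$, $(a,b)\mapsto a_\lambda b$, with $(\partial a)_\lambda b=-\lambda a_\lambda b$, $a_\lambda(\partial b)=(\partial+\lambda)(a_\lambda b)$. A noncommutative Poisson conformal algebra $(P,\circ_\lambda,[\cdot_\lambda\cdot])$ is a $\mathbb{C}[\partial]$-module such that both operations are conformal algebra structures, $a\circ_\lambda(b\circ_\mu c)=(a\circ_\lambda b)\circ_{\lambda+\mu}c$, $[a_\lambda b]=-[b_{-\lambda-\partial}a]$, $[a_\lambda[b_\mu c]]=[[a_\lambda b]_{\lambda+\mu}c]+[b_\mu[a_\lambda c]]$, and $[a_\lambda(b\circ_\mu c)]=[a_\lambda b]\circ_{\lambda+\mu}c+b\circ_\mu[a_\lambda c]$. A homomorphism of noncommutative Poisson conformal algebras is a linear map commuting with $\partial$ and preserving both $\lambda$-operations. Linear deformations.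 Let $\varpi,\omega:P\otimes P\to P[\lambda]$ be linear maps, written $\{a_\lambda b\}_\varpi$, $\{a_\lambda b\}_\omega$, and put $a\circ_{t\lambda}b=a\circ_\lambda b+t\{a_\lambda b\}_\varpi$, $[a_\lambda b]_t=[a_\lambda b]+t\{a_\lambda b\}_\omega$. If $P_t=(P,\circ_{t\lambda},[\cdot_\lambda\cdot]_t)$ (with the same $\partial$) is a noncommutative Poisson conformal algebra for all $t\in\mathbb{R}$, then $(\varpi,\omega)$ is said to generate the linear deformation $P_t$ of $P$. Two linear deformations $P_t,P'_t$ are equivalent if there is a linear map $N:P\to P$ such that $\mathrm{Id}+tN:P_t\to P'_t$ is a homomorphism of noncommutative Poisson conformal algebras for all $t$. Cohomology in degree $2$ with coefficients in $P$ itself (viewed as a module over $P$ by left and right $\lambda$-multiplication and the $\lambda$-bracket). A $k$-$\lambda$-bracket on $P$ is a linear map $\gamma:P^{\otimes k}\to\mathbb{C}[\lambda_1,\dots,\lambda_{k-1}]\otimes P$, $a_1\otimes\cdots\otimes a_k\mapsto\{a_{1\,\lambda_1}\cdots a_{k-1\,\lambda_{k-1}}a_k\}_\gamma$, such that replacing $a_i$ by $\partial a_i$ multiplies by $-\lambda_i$ for $i\le k-1$ and replacing $a_k$ by $\partial a_k$ multiplies by $\lambda_1+\cdots+\lambda_{k-1}+\partial$. $C^{1,0}(P,P)$ is the space of $\mathbb{C}[\partial]$-module homomorphisms $P\to P$; $C^{2,0}(P,P)$ is the space of $2$-$\lambda$-brackets $\gamma$ with $\{a_\lambda b\}_\gamma=-\{b_{-\lambda-\partial}a\}_\gamma$;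 $C^{0,2}(P,P)$ the space of all $2$-$\lambda$-brackets; $C^{3,0}(P,P)$ the space of $3$-$\lambda$-brackets that are skew-symmetric under simultaneous permutation of arguments and variables, where $\lambda_3$ is read as $-\lambda_1-\lambda_2-\partial$ with $\partial$ moved to the left; $C^{1,2}(P,P)$ and $C^{0,3}(P,P)$ are both the space of all $3$-$\lambda$-brackets. Set $C^1_{\mathrm{FGV}}(P,P)=C^{1,0}$, $C^2_{\mathrm{FGV}}(P,P)=C^{2,0}\oplus C^{0,2}$, $C^3_{\mathrm{FGV}}(P,P)=C^{3,0}\oplus C^{1,2}\oplus C^{0,3}$. For $\gamma\in C^{1,0}$, $\mathrm d_{\mathrm{FGV}}\gamma$ has $C^{2,0}$-component $$(a,b)\mapsto[a_\lambda\gamma(b)]-[b_{-\lambda-\partial}\gamma(a)]-\gamma([a_\lambda b])=[a_\lambda\gamma(b)]+[\gamma(a)_\lambda b]-\gamma([a_\lambda b])$$ and $C^{0,2}$-component $(a,b)\mapsto a\circ_\lambda\gamma(b)-\gamma(a\circ_\lambda b)+\gamma(a)\circ_\lambda b$. For $\omega\in C^{2,0}$, $\varpi\in C^{0,2}$, $\mathrm d_{\mathrm{FGV}}(\omega+\varpi)$ has components $\mathrm d_{\mathrm{CE}}\omega\in C^{3,0}$, $\mathrm d^{0,2}_{\mathrm{CE}}\varpi-\mathrm d^{1,1}_{\mathrm H}\omega\in C^{1,2}$, $\mathrm d^{0,2}_{\mathrm H}\varpi\in C^{0,3}$, where $$\{a_\lambda b_\mu c\}_{\mathrm d_{\mathrm{CE}}\omega}=[a_\lambda\{b_\mu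 c\}_\omega]-[b_\mu\{a_\lambda c\}_\omega]+\{c_{-\lambda-\mu-\partial}[a_\lambda b]\}_\omega+[c_{-\lambda-\mu-\partial}\{a_\lambda b\}_\omega]-\{b_\mu[a_\lambda c]\}_\omega+\{a_\lambda[b_\mu c]\}_\omega,$$ $$\{a_\lambda b_\mu c\}_{\mathrm d^{0,2}_{\mathrm{CE}}\varpi}=[a_\lambda\{b_\mu c\}_\varpi]-\{[a_\lambda b]_{\lambda+\mu}c\}_\varpi-\{b_\mu[a_\lambda c]\}_\varpi,$$ $$\{a_\lambda b_\mu c\}_{\mathrm d^{1,1}_{\mathrm H}\omega}=b\circ_\mu\{a_\lambda c\}_\omega-\{a_\lambda(b\circ_\mu c)\}_\omega+\{a_\lambda b\}_\omega\circ_{\lambda+\mu}c,$$ $$\{a_\lambda b_\mu c\}_{\mathrm d^{0,2}_{\mathrm H}\varpi}=a\circ_\lambda\{b_\mu c\}_\varpi-\{(a\circ_\lambda b)_{\lambda+\mu}c\}_\varpi+\{a_\lambda(b\circ_\mu c)\}_\varpi-\{a_\lambda b\}_\varpi\circ_{\lambda+\mu}c.$$ $H^2_{\mathrm{FGV}}(P,P)$ is the quotient of the kernel of $\mathrm d_{\mathrm{FGV}}$ on $C^2_{\mathrm{FGV}}$ by $\mathrm d_{\mathrm{FGV}}(C^1_{\mathrm{FGV}})$. If $(\varpi,\omega)$ generates a linear deformation, then $\omega\in C^{2,0}$, $\varpi\in C^{0,2}$ and $\omega+\varpi$ is a $2$-cocycle. *)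

theory Defs
  imports
    Complex_Main
    "HOL-Computational_Algebra.Polynomial"
    "HOL-Library.Function_Algebras"
    "HOL-Library.Product_Plus"
begin

text \<open>
  A \<open>\<complex>[\<partial>]\<close>-module is a library \<open>module\<close> with action
  \<open>act :: complex poly \<Rightarrow> 'p \<Rightarrow> 'p\<close>; the underlying complex vector space structure is the
  action of the constant polynomials.  The space \<open>P[\<lambda>]\<close> is the type \<open>'p poly\<close>, and
  \<open>P[\<lambda>,\<mu>]\<close> is \<open>'p poly poly\<close>, where the outer variable is \<open>\<mu>\<close> and the inner one is \<open>\<lambda>\<close>.
\<close>

type_synonym 'p action = "complex poly \<Rightarrow> 'p \<Rightarrow> 'p"
type_synonym 'p lprod = "'p \<Rightarrow> 'p \<Rightarrow> 'p poly"

definition cscale :: "'p action \<Rightarrow> complex \<Rightarrow> 'p \<Rightarrow> 'p" where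
  "cscale act c = act [:c:]"

definition deriv_op :: "'p action \<Rightarrow> 'p \<Rightarrow> 'p" where
  "deriv_op act = act [:0, 1:]"

definition cscale_poly :: "'p::ab_group_add action \<Rightarrow> complex \<Rightarrow> 'p poly \<Rightarrow> 'p poly" where
  "cscale_poly act c = map_poly (cscale act c)"

subsection \<open>Substituting for the variable of a \<open>\<lambda>\<close>-product\<close>

text \<open>
  \<open>op_subst T e (\<Sum>i. x\<^sub>i \<nu>^i) = (\<Sum>i. T^i (e x\<^sub>i))\<close>: the variable \<open>\<nu>\<close> is replaced by the operator
  \<open>T\<close>, written to the left of the coefficients.
\<close>

definition op_subst :: "('m \<Rightarrow> 'm) \<Rightarrow> ('a::zero \<Rightarrow> 'm) \<Rightarrow> 'a poly \<Rightarrow> 'm::comm_monoid_add" where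
  "op_subst T e p = (\<Sum>i\<le>degree p. (T ^^ i) (e (coeff p i)))"

text \<open>\<open>swap_prod act f a b\<close> is \<open>b\<^sub>\<nu> a\<close> at \<open>\<nu> = -\<lambda>-\<partial>\<close>, an element of \<open>P[\<lambda>]\<close>.\<close>

definition swap_prod :: "'p::ab_group_add action \<Rightarrow> 'p lprod \<Rightarrow> 'p lprod" where
  "swap_prod act f a b =
     op_subst (\<lambda>q. - pCons 0 q - map_poly (deriv_op act) q) (\<lambda>x. [:x:]) (f b a)"

text \<open>The operators \<open>\<lambda>\<close>, \<open>\<mu>\<close>, \<open>\<lambda>+\<mu>\<close> and \<open>-\<lambda>-\<mu>-\<partial>\<close> on \<open>P[\<lambda>,\<mu>]\<close>.\<close>

definition lam :: "'p::ab_group_add poly poly \<Rightarrow> 'p poly poly" where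
  "lam = map_poly (pCons 0)"

definition mu :: "'p::ab_group_add poly poly \<Rightarrow> 'p poly poly" where
  "mu = pCons 0"

definition lam_mu :: "'p::ab_group_add poly poly \<Rightarrow> 'p poly poly" where
  "lam_mu q = lam q + mu q"

definition neg_lam_mu :: "'p::ab_group_add action \<Rightarrow> 'p poly poly \<Rightarrow> 'p poly poly" where
  "neg_lam_mu act q = - lam q - mu q - map_poly (map_poly (deriv_op act)) q"

text \<open>
  With \<open>f\<close>, \<open>g\<close> two \<open>\<lambda>\<close>-products and \<open>S\<close>, \<open>T\<close> operators on \<open>P[\<lambda>,\<mu>]\<close>,
  \<open>right_nest f S g T a b c\<close> is \<open>a f\<^sub>S (b g\<^sub>T c)\<close> and
  \<open>left_nest f S g T a b c\<close> is \<open>(a g\<^sub>T b) f\<^sub>S c\<close>.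
\<close>

definition right_nest ::
  "'p::ab_group_add lprod \<Rightarrow> ('p poly poly \<Rightarrow> 'p poly poly) \<Rightarrow> 'p lprod \<Rightarrow>
   ('p poly poly \<Rightarrow> 'p poly poly) \<Rightarrow> 'p \<Rightarrow> 'p \<Rightarrow> 'p \<Rightarrow> 'p poly poly" where
  "right_nest f S g T a b c =
     op_subst T (\<lambda>x. op_subst S (\<lambda>y. [:[:y:]:]) (f a x)) (g b c)"

definition left_nest ::
  "'p::ab_group_add lprod \<Rightarrow> ('p poly poly \<Rightarrow> 'p poly poly) \<Rightarrow> 'p lprod \<Rightarrow>
   ('p poly poly \<Rightarrow> 'p poly poly) \<Rightarrow> 'p \<Rightarrow> 'p \<Rightarrow> 'p \<Rightarrow> 'p poly poly" where
  "left_nest f S g T a b c =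
     op_subst T (\<lambda>x. op_subst S (\<lambda>y. [:[:y:]:]) (f x c)) (g a b)"

subsection \<open>Noncommutative Poisson conformal algebras\<close>

text \<open>Complex bilinear maps \<open>P \<times> P \<rightarrow> P[\<lambda>]\<close>, i.e. linear maps on the tensor square over \<open>\<complex>\<close>.\<close>

definition bilinear_prod :: "'p::ab_group_add action \<Rightarrow> 'p lprod \<Rightarrow> bool" where
  "bilinear_prod act f \<longleftrightarrow>
     (\<forall>a. Vector_Spaces.linear (cscale act) (cscale_poly act) (\<lambda>b. f a b)) \<and>
     (\<forall>b. Vector_Spaces.linear (cscale act) (cscale_poly act) (\<lambda>a. f a b))"

text \<open>The \<open>2\<close>-\<open>\<lambda>\<close>-brackets are exactly the operations that occur in conformal algebras.\<close>

definition lambda_bracket2 :: "'p::ab_group_add action \<Rightarrow> 'p lprod \<Rightarrow> bool" where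
  "lambda_bracket2 act f \<longleftrightarrow> bilinear_prod act f \<and>
     (\<forall>a b. f (deriv_op act a) b = - pCons 0 (f a b)) \<and>
     (\<forall>a b. f a (deriv_op act b) = map_poly (deriv_op act) (f a b) + pCons 0 (f a b))"

locale conformal_algebra = module act
  for act :: "complex poly \<Rightarrow> 'p::ab_group_add \<Rightarrow> 'p" +
  fixes f :: "'p \<Rightarrow> 'p \<Rightarrow> 'p poly"
  assumes lambda_bracket2: "lambda_bracket2 act f"

locale nc_poisson_conformal_algebra =
  mul: conformal_algebra act mul + brk: conformal_algebra act brk
  for act :: "complex poly \<Rightarrow> 'p::ab_group_add \<Rightarrow> 'p"
    and mul :: "'p \<Rightarrow> 'p \<Rightarrow> 'p poly"
    and brk :: "'p \<Rightarrow> 'p \<Rightarrow> 'p poly" +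
  assumes assoc:
      "right_nest mul lam mul mu a b c = left_nest mul lam_mu mul lam a b c"
    and skew: "brk a b = - swap_prod act brk a b"
    and jacobi:
      "right_nest brk lam brk mu a b c =
         left_nest brk lam_mu brk lam a b c + right_nest brk mu brk lam b a c"
    and leibniz:
      "right_nest brk lam mul mu a b c =
         left_nest mul lam_mu brk lam a b c + right_nest mul mu brk lam b a c"

definition npca_hom ::
  "'p::ab_group_add action \<Rightarrow> 'p lprod \<Rightarrow> 'p lprod \<Rightarrow>
   'q::ab_group_add action \<Rightarrow> 'q lprod \<Rightarrow> 'q lprod \<Rightarrow> ('p \<Rightarrow> 'q) \<Rightarrow> bool" where
  "npca_hom act mul brk act' mul' brk' \<phi> \<longleftrightarrow>
     Vector_Spaces.linear (cscale act) (cscale act') \<phi> \<and>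
     (\<forall>a. \<phi> (deriv_op act a) = deriv_op act' (\<phi> a)) \<and>
     (\<forall>a b. map_poly \<phi> (mul a b) = mul' (\<phi> a) (\<phi> b)) \<and>
     (\<forall>a b. map_poly \<phi> (brk a b) = brk' (\<phi> a) (\<phi> b))"

subsection \<open>Linear deformations\<close>

definition deform_prod ::
  "'p::ab_group_add action \<Rightarrow> 'p lprod \<Rightarrow> 'p lprod \<Rightarrow> real \<Rightarrow> 'p lprod" where
  "deform_prod act f \<gamma> t a b = f a b + cscale_poly act (of_real t) (\<gamma> a b)"

text \<open>\<open>\<pi>\<close> (the paper's varpi) deforms the associative product, \<open>\<omega>\<close> the bracket; the parameter \<open>t\<close> is real.\<close>

definition generates_linear_deformation ::
  "'p::ab_group_add action \<Rightarrow> 'p lprod \<Rightarrow> 'p lprod \<Rightarrow> 'p lprod \<Rightarrow> 'p lprod \<Rightarrow> bool" where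
  "generates_linear_deformation act mul brk \<pi> \<omega> \<longleftrightarrow>
     bilinear_prod act \<pi> \<and> bilinear_prod act \<omega> \<and>
     (\<forall>t. nc_poisson_conformal_algebra act (deform_prod act mul \<pi> t) (deform_prod act brk \<omega> t))"

definition equivalent_deformations ::
  "'p::ab_group_add action \<Rightarrow> 'p lprod \<Rightarrow> 'p lprod \<Rightarrow> 'p lprod \<Rightarrow> 'p lprod \<Rightarrow>
   'p lprod \<Rightarrow> 'p lprod \<Rightarrow> bool" where
  "equivalent_deformations act mul brk \<pi> \<omega> \<pi>' \<omega>' \<longleftrightarrow>
     (\<exists>N. Vector_Spaces.linear (cscale act) (cscale act) N \<and>
       (\<forall>t::real. npca_hom
          act (deform_prod act mul \<pi> t) (deform_prod act brk \<omega> t)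
          act (deform_prod act mul \<pi>' t) (deform_prod act brk \<omega>' t)
          (\<lambda>x. x + cscale act (of_real t) (N x))))"

subsection \<open>Second cohomology\<close>

definition C10 :: "'p::ab_group_add action \<Rightarrow> ('p \<Rightarrow> 'p) set" where
  "C10 act = {\<gamma>. module_hom act act \<gamma>}"

definition C20 :: "'p::ab_group_add action \<Rightarrow> 'p lprod set" where
  "C20 act = {\<gamma>. lambda_bracket2 act \<gamma> \<and> (\<forall>a b. \<gamma> a b = - swap_prod act \<gamma> a b)}"

definition C02 :: "'p::ab_group_add action \<Rightarrow> 'p lprod set" where
  "C02 act = {\<gamma>. lambda_bracket2 act \<gamma>}"

definition C1_FGV :: "'p::ab_group_add action \<Rightarrow> ('p \<Rightarrow> 'p) set" where
  "C1_FGV act = C10 act"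

text \<open>The cochain \<open>\<omega> + \<pi>\<close> of the direct sum is the pair \<open>(\<omega>, \<pi>)\<close>.\<close>

definition C2_FGV :: "'p::ab_group_add action \<Rightarrow> ('p lprod \<times> 'p lprod) set" where
  "C2_FGV act = C20 act \<times> C02 act"

definition d1_FGV ::
  "'p::ab_group_add action \<Rightarrow> 'p lprod \<Rightarrow> 'p lprod \<Rightarrow> ('p \<Rightarrow> 'p) \<Rightarrow> 'p lprod \<times> 'p lprod" where
  "d1_FGV act mul brk \<gamma> =
     ((\<lambda>a b. brk a (\<gamma> b) - swap_prod act brk (\<gamma> a) b - map_poly \<gamma> (brk a b)),
      (\<lambda>a b. mul a (\<gamma> b) - map_poly \<gamma> (mul a b) + mul (\<gamma> a) b))"

definition d_CE ::
  "'p::ab_group_add action \<Rightarrow> 'p lprod \<Rightarrow> 'p lprod \<Rightarrow> 'p \<Rightarrow> 'p \<Rightarrow> 'p \<Rightarrow> 'p poly poly" where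
  "d_CE act brk \<omega> a b c =
     right_nest brk lam \<omega> mu a b c
     - right_nest brk mu \<omega> lam b a c
     + right_nest \<omega> (neg_lam_mu act) brk lam c a b
     + right_nest brk (neg_lam_mu act) \<omega> lam c a b
     - right_nest \<omega> mu brk lam b a c
     + right_nest \<omega> lam brk mu a b c"

definition d02_CE ::
  "'p::ab_group_add lprod \<Rightarrow> 'p lprod \<Rightarrow> 'p \<Rightarrow> 'p \<Rightarrow> 'p \<Rightarrow> 'p poly poly" where
  "d02_CE brk \<pi> a b c =
     right_nest brk lam \<pi> mu a b c
     - left_nest \<pi> lam_mu brk lam a b c
     - right_nest \<pi> mu brk lam b a c"

definition d11_H ::
  "'p::ab_group_add lprod \<Rightarrow> 'p lprod \<Rightarrow> 'p \<Rightarrow> 'p \<Rightarrow> 'p \<Rightarrow> 'p poly poly" where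
  "d11_H mul \<omega> a b c =
     right_nest mul mu \<omega> lam b a c
     - right_nest \<omega> lam mul mu a b c
     + left_nest mul lam_mu \<omega> lam a b c"

definition d02_H ::
  "'p::ab_group_add lprod \<Rightarrow> 'p lprod \<Rightarrow> 'p \<Rightarrow> 'p \<Rightarrow> 'p \<Rightarrow> 'p poly poly" where
  "d02_H mul \<pi> a b c =
     right_nest mul lam \<pi> mu a b c
     - left_nest \<pi> lam_mu mul lam a b c
     + right_nest \<pi> lam mul mu a b c
     - left_nest mul lam_mu \<pi> lam a b c"

text \<open>The three components lie in \<open>C\<^sup>3\<^sup>,\<^sup>0\<close>, \<open>C\<^sup>1\<^sup>,\<^sup>2\<close> and \<open>C\<^sup>0\<^sup>,\<^sup>3\<close>.\<close>

definition d2_FGV ::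
  "'p::ab_group_add action \<Rightarrow> 'p lprod \<Rightarrow> 'p lprod \<Rightarrow> 'p lprod \<times> 'p lprod \<Rightarrow>
   ('p \<Rightarrow> 'p \<Rightarrow> 'p \<Rightarrow> 'p poly poly) \<times> ('p \<Rightarrow> 'p \<Rightarrow> 'p \<Rightarrow> 'p poly poly) \<times>
   ('p \<Rightarrow> 'p \<Rightarrow> 'p \<Rightarrow> 'p poly poly)" where
  "d2_FGV act mul brk = (\<lambda>(\<omega>, \<pi>).
     (d_CE act brk \<omega>, d02_CE brk \<pi> - d11_H mul \<omega>, d02_H mul \<pi>))"

definition Z2_FGV ::
  "'p::ab_group_add action \<Rightarrow> 'p lprod \<Rightarrow> 'p lprod \<Rightarrow> ('p lprod \<times> 'p lprod) set" where
  "Z2_FGV act mul brk = {x \<in> C2_FGV act. d2_FGV act mul brk x = 0}"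

definition B2_FGV ::
  "'p::ab_group_add action \<Rightarrow> 'p lprod \<Rightarrow> 'p lprod \<Rightarrow> ('p lprod \<times> 'p lprod) set" where
  "B2_FGV act mul brk = d1_FGV act mul brk ` C1_FGV act"

text \<open>The elements of \<open>H\<^sup>2\<close> are the cohomology classes, as sets of cocycles.\<close>

definition H2_FGV ::
  "'p::ab_group_add action \<Rightarrow> 'p lprod \<Rightarrow> 'p lprod \<Rightarrow> ('p lprod \<times> 'p lprod) set set" where
  "H2_FGV act mul brk = Z2_FGV act mul brk //
     {(x, y). x \<in> Z2_FGV act mul brk \<and> y \<in> Z2_FGV act mul brk \<and> x - y \<in> B2_FGV act mul brk}"

end

theory Submission
  imports Defs
begin

text \<open>
  Everything comes from comparing coefficients of \<open>t\<close>.  Associativity, the Leibniz rule and the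
  Jacobi identity of \<open>P\<^sub>t\<close> are identities between compositions of two deformed products, hence
  polynomial of degree two in \<open>t\<close>; their linear coefficients give the three components of
  \<open>d (\<omega>, \<pi>) = 0\<close>.  The other axioms are linear in the products, so \<open>\<omega>\<close> and \<open>\<pi>\<close> inherit them.  That \<open>Id + tN\<close> preserves the
  products is an identity of degree three in \<open>t\<close>, whose linear coefficient reads
  \<open>(\<omega>, \<pi>) - (\<omega>', \<pi>') = d N\<close>; and \<open>N\<close> is a cochain because \<open>Id + N\<close> commutes with \<open>\<partial>\<close>.

  Linear coefficients can be isolated by evaluation at finitely many small integers: at
  \<open>t = 1, -1\<close> for degree two and at \<open>t = 1, -1, 2\<close> for degree three.  At integers scalar
  multiplication is repeated addition, so the comparison rests on the biadditivity of the products
  (\<open>right_nest_first_order\<close>, \<open>left_nest_first_order\<close>, \<open>first_order_of_equivalence\<close>), plus the fact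
  that a complex vector space has no torsion by \<open>2\<close> or \<open>3\<close>, which allows the remaining integer
  factors to be cancelled.

  The Chevalley-Eilenberg differential contains arguments at \<open>-\<lambda>-\<mu>-\<partial>\<close> where the Jacobi identity has
  \<open>\<lambda>+\<mu>\<close>.  These agree up to sign by skew-symmetry, since substituting \<open>\<lambda>+\<mu>\<close> for \<open>\<lambda>\<close> turns
  \<open>-\<lambda>-\<partial>\<close> into \<open>-\<lambda>-\<mu>-\<partial>\<close> (\<open>right_nest_neg_lam_mu\<close>).
\<close>

section \<open>Scalars\<close>

lemma deriv_op_additive: "module act \<Longrightarrow> additive (deriv_op act)"
  by (simp add: additive_def deriv_op_def module.scale_right_distrib)

lemma double_eq_zero_imp_zero:
  fixes x :: "'p::ab_group_add"
  assumes "module (act :: complex poly \<Rightarrow> 'p \<Rightarrow> 'p)" "x + x = 0"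
  shows "x = 0"
proof -
  interpret module act by fact
  have "x = act ([:1/2:] * [:2:]) x" by (simp flip: one_pCons)
  also have "\<dots> = act [:1/2:] (act ([:1:] + [:1:]) x)" by simp
  also have "act ([:1:] + [:1:]) x = 0"
    using assms(2) by (simp only: scale_left_distrib scale_one flip: one_pCons)
  finally show ?thesis by simp
qed

lemma triple_eq_zero_imp_zero:
  fixes x :: "'p::ab_group_add"
  assumes "module (act :: complex poly \<Rightarrow> 'p \<Rightarrow> 'p)" "x + x + x = 0"
  shows "x = 0"
proof -
  interpret module act by fact
  have "x = act ([:1/3:] * [:3:]) x" by (simp flip: one_pCons)
  also have "\<dots> = act [:1/3:] (act ([:1:] + [:1:] + [:1:]) x)" by simp
  also have "act ([:1:] + [:1:] + [:1:]) x = 0"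
    using assms(2) by (simp only: scale_left_distrib scale_one flip: one_pCons)
  finally show ?thesis by simp
qed

lemma double_poly_eq_zero_imp_zero:
  fixes q :: "'p::ab_group_add poly"
  assumes "module (act :: complex poly \<Rightarrow> 'p \<Rightarrow> 'p)" "q + q = 0"
  shows "q = 0"
proof (rule poly_eqI)
  fix n
  have "coeff q n + coeff q n = 0" using arg_cong[OF assms(2), of "\<lambda>r. coeff r n"] by simp
  then have "coeff q n = 0" by (rule double_eq_zero_imp_zero[OF assms(1)])
  then show "coeff q n = coeff 0 n" by simp
qed

lemma triple_poly_eq_zero_imp_zero:
  fixes q :: "'p::ab_group_add poly"
  assumes "module (act :: complex poly \<Rightarrow> 'p \<Rightarrow> 'p)" "q + q + q = 0"
  shows "q = 0"
proof (rule poly_eqI)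
  fix n
  have "coeff q n + coeff q n + coeff q n = 0" using arg_cong[OF assms(2), of "\<lambda>r. coeff r n"] by simp
  then have "coeff q n = 0" by (rule triple_eq_zero_imp_zero[OF assms(1)])
  then show "coeff q n = coeff 0 n" by simp
qed

lemma double_poly_poly_eq_zero_imp_zero:
  fixes q :: "'p::ab_group_add poly poly"
  assumes "module (act :: complex poly \<Rightarrow> 'p \<Rightarrow> 'p)" "q + q = 0"
  shows "q = 0"
proof (rule poly_eqI)
  fix n
  have "coeff q n + coeff q n = 0" using arg_cong[OF assms(2), of "\<lambda>r. coeff r n"] by simp
  then have "coeff q n = 0" by (rule double_poly_eq_zero_imp_zero[OF assms(1)])
  then show "coeff q n = coeff 0 n" by simp
qed

text \<open>
  At \<open>t = 1, -1, 2\<close> scaling by \<open>t\<close> is expressible by addition and negation, so that additivity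
  alone suffices to expand the deformed operations.
\<close>

lemma cscale_of_small_int:
  assumes "module act"
  shows "cscale act 1 x = x" "cscale act (- 1) x = - x" "cscale act 2 x = x + x"
proof -
  interpret module act by fact
  show 1: "cscale act 1 x = x"
    unfolding cscale_def by (simp flip: one_pCons)
  have "[:-1:] = - (1 :: complex poly)" by (simp add: one_pCons)
  then show "cscale act (- 1) x = - x"
    unfolding cscale_def by (simp only: scale_minus_left scale_one)
  have "[:2:] = 1 + (1 :: complex poly)" by (simp add: one_pCons)
  then show "cscale act 2 x = x + x"
    unfolding cscale_def by (simp only: scale_left_distrib scale_one)
qed

lemma deform_prod_at_small_int:
  assumes "module act"
  shows "deform_prod act f \<gamma> 1 = f + \<gamma>" "deform_prod act f \<gamma> (- 1) = f - \<gamma>"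
    "deform_prod act f \<gamma> 2 = f + \<gamma> + \<gamma>"
proof -
  have "cscale_poly act 1 q = q" "cscale_poly act (- 1) q = - q"
    "cscale_poly act 2 q = q + q" for q
    unfolding cscale_poly_def
    by (rule poly_eqI; simp add: coeff_map_poly cscale_of_small_int[OF assms])+
  then show "deform_prod act f \<gamma> 1 = f + \<gamma>" "deform_prod act f \<gamma> (- 1) = f - \<gamma>"
    "deform_prod act f \<gamma> 2 = f + \<gamma> + \<gamma>"
    by (auto simp: deform_prod_def fun_eq_iff add.assoc)
qed

text \<open>
  A complex-linear map that commutes with \<open>\<partial>\<close> is a \<open>\<complex>[\<partial>]\<close>-homomorphism, because constants and
  \<open>\<partial>\<close> generate \<open>\<complex>[\<partial>]\<close>.
\<close>

lemma module_hom_of_linear_commuting: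
  assumes "module act" and "Vector_Spaces.linear (cscale act) (cscale act) N"
    and comm: "\<And>x. N (deriv_op act x) = deriv_op act (N x)"
  shows "module_hom act act N"
proof -
  interpret module act by fact
  interpret L: Vector_Spaces.linear "cscale act" "cscale act" N by fact
  have "N (act r x) = act r (N x)" for r x
  proof (induction r arbitrary: x)
    case 0
    show ?case by (simp add: L.zero)
  next
    case (pCons c r)
    have split: "act (pCons c r) y = cscale act c y + deriv_op act (act r y)" for y
    proof -
      have "pCons c r = [:c:] + [:0, 1:] * r" by simp
      then show ?thesis
        unfolding cscale_def deriv_op_def by (simp only: scale_left_distrib scale_scale)
    qed
    show ?case
      by (simp add: split L.add L.scale comm pCons.IH)
  qed
  then show ?thesis
    by unfold_locales (auto simp: L.add)
qed

section \<open>Additivity of substitution and composition\<close>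

lemma additive_funpow:
  fixes T :: "'m::ab_group_add \<Rightarrow> 'm"
  assumes "additive T"
  shows "additive (T ^^ i)"
  by standard (induction i; simp add: additive.add[OF assms])

lemma additive_map_poly:
  assumes "additive h"
  shows "additive (map_poly h)"
  by standard
    (simp add: poly_eq_iff coeff_map_poly additive.zero[OF assms] additive.add[OF assms])

lemma additive_pCons_0: "additive (pCons 0)"
  by (simp add: additive_def)

lemma additive_lam: "additive lam"
  unfolding lam_def by (intro additive_map_poly additive_pCons_0)

lemma additive_mu: "additive mu"
  unfolding mu_def by (rule additive_pCons_0)

lemma additive_lam_mu: "additive lam_mu"
  by standard
    (simp add: lam_mu_def additive.add[OF additive_lam] additive.add[OF additive_mu] ac_simps)

lemma op_subst_eq_sum:
  fixes T :: "'m::ab_group_add \<Rightarrow> 'm"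
  assumes "additive T" "e 0 = 0" "degree p \<le> n"
  shows "op_subst T e p = (\<Sum>i\<le>n. (T ^^ i) (e (coeff p i)))"
  unfolding op_subst_def
  by (rule sum.mono_neutral_left)
     (use assms in \<open>auto simp: coeff_eq_0 additive.zero[OF additive_funpow]\<close>)

lemma additive_op_subst:
  fixes T :: "'m::ab_group_add \<Rightarrow> 'm" and e :: "'a::ab_group_add \<Rightarrow> 'm"
  assumes "additive T" "additive e"
  shows "additive (op_subst T e)"
proof
  fix p q :: "'a poly"
  let ?n = "max (degree p) (degree q)"
  have "degree (p + q) \<le> ?n" by (rule degree_add_le_max)
  then show "op_subst T e (p + q) = op_subst T e p + op_subst T e q"
    using op_subst_eq_sum[where e = e and n = ?n, OF assms(1) additive.zero[OF assms(2)]]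
    by (simp add: additive.add[OF assms(2)] additive.add[OF additive_funpow[OF assms(1)]]
        sum.distrib)
qed

lemma op_subst_add_fun:
  fixes T :: "'m::ab_group_add \<Rightarrow> 'm"
  assumes "additive T"
  shows "op_subst T (\<lambda>x. e x + e' x) p = op_subst T e p + op_subst T e' p"
  by (simp add: op_subst_def additive.add[OF additive_funpow[OF assms]] sum.distrib)

lemma additive_const_const: "additive (\<lambda>y. [:[:y:]:])"
  by (simp add: additive_def)

lemma additive_right_nest_outer:
  assumes "additive S" "additive T"
  shows "additive (\<lambda>f. right_nest f S g T a b c)"
  by standard
     (simp add: right_nest_def op_subst_add_fun[OF assms(2)]
       additive.add[OF additive_op_subst[OF assms(1) additive_const_const]])

lemma additive_left_nest_outer:
  assumes "additive S" "additive T"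
  shows "additive (\<lambda>f. left_nest f S g T a b c)"
  by standard
     (simp add: left_nest_def op_subst_add_fun[OF assms(2)]
       additive.add[OF additive_op_subst[OF assms(1) additive_const_const]])

lemma additive_right_nest_inner:
  assumes "additive S" "additive T" "additive (f a)"
  shows "additive (\<lambda>g. right_nest f S g T a b c)"
proof -
  have "additive (\<lambda>x. op_subst S (\<lambda>y. [:[:y:]:]) (f a x))"
    by standard (simp add: additive.add[OF assms(3)]
      additive.add[OF additive_op_subst[OF assms(1) additive_const_const]])
  from additive_op_subst[OF assms(2) this] show ?thesis
    by (simp add: additive_def right_nest_def)
qed

lemma additive_left_nest_inner:
  assumes "additive S" "additive T" "additive (\<lambda>x. f x c)"
  shows "additive (\<lambda>g. left_nest f S g T a b c)"
proof -
  have "additive (\<lambda>x. op_subst S (\<lambda>y. [:[:y:]:]) (f x c))"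
    by standard (simp add: additive.add[OF assms(3)]
      additive.add[OF additive_op_subst[OF assms(1) additive_const_const]])
  from additive_op_subst[OF assms(2) this] show ?thesis
    by (simp add: additive_def left_nest_def)
qed

section \<open>Linear coefficients of compositions\<close>

text \<open>
  For biadditive \<open>B\<close>, the values of \<open>B (f + t u) (g + t v)\<close> at \<open>t = 1\<close> and \<open>t = -1\<close> differ by twice
  the linear coefficient.  The factor \<open>2\<close> appears as a repeated summand because \<open>P[\<lambda>,\<mu>]\<close> is only
  used as an abelian group.
\<close>

lemma right_nest_first_order:
  assumes "additive S" "additive T" "additive (f a)" "additive (u a)"
  shows "right_nest (f + u) S (g + v) T a b c - right_nest (f - u) S (g - v) T a b c =
    (right_nest f S v T a b c + right_nest u S g T a b c) +
    (right_nest f S v T a b c + right_nest u S g T a b c)"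
proof -
  note outer = additive_right_nest_outer[OF assms(1,2)]
  note inner = additive_right_nest_inner[where f = f, OF assms(1-3)]
    additive_right_nest_inner[where f = u, OF assms(1,2,4)]
  show ?thesis
    by (simp add: additive.add[OF outer] additive.diff[OF outer]
        inner[THEN additive.add] inner[THEN additive.diff] algebra_simps)
qed

lemma left_nest_first_order:
  assumes "additive S" "additive T" "additive (\<lambda>x. f x c)" "additive (\<lambda>x. u x c)"
  shows "left_nest (f + u) S (g + v) T a b c - left_nest (f - u) S (g - v) T a b c =
    (left_nest f S v T a b c + left_nest u S g T a b c) +
    (left_nest f S v T a b c + left_nest u S g T a b c)"
proof -
  note outer = additive_left_nest_outer[OF assms(1,2)]
  note inner = additive_left_nest_inner[where f = f, OF assms(1-3)]
    additive_left_nest_inner[where f = u, OF assms(1,2,4)]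
  show ?thesis
    by (simp add: additive.add[OF outer] additive.diff[OF outer]
        inner[THEN additive.add] inner[THEN additive.diff] algebra_simps)
qed

section \<open>Skew-symmetry\<close>

lemma additive_swap_operator:
  assumes "module act"
  shows "additive (\<lambda>q. - pCons 0 q - map_poly (deriv_op act) q)"
  by standard (simp add: additive.add[OF additive_map_poly[OF deriv_op_additive[OF assms]]]
    algebra_simps)

lemma additive_swap_prod:
  assumes "module act"
  shows "additive (\<lambda>f. swap_prod act f a b)"
proof -
  have "additive (\<lambda>x::'a. [:x:])" by (simp add: additive_def)
  from additive_op_subst[OF additive_swap_operator[OF assms] this] show ?thesis
    by (simp add: additive_def swap_prod_def)
qed

lemma map_poly_pCons_0:
  "h 0 = 0 \<Longrightarrow> map_poly h (pCons 0 q) = pCons 0 (map_poly h q)"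
  by (cases "q = 0") (auto simp: map_poly_pCons)

text \<open>
  The substitution \<open>\<lambda> \<mapsto> \<lambda>+\<mu>\<close> intertwines \<open>-\<lambda>-\<partial>\<close> with \<open>-\<lambda>-\<mu>-\<partial>\<close>, because \<open>\<partial>\<close> commutes with \<open>\<lambda>\<close> and
  \<open>\<mu>\<close>; so it carries powers of the one applied to constants to powers of the other.
\<close>

lemma op_subst_lam_mu_swap:
  assumes m: "module act"
  shows "op_subst lam_mu (\<lambda>y. [:[:y:]:])
      (op_subst (\<lambda>q. - pCons 0 q - map_poly (deriv_op act) q) (\<lambda>x. [:x:]) p) =
    op_subst (neg_lam_mu act) (\<lambda>y. [:[:y:]:]) p"
proof -
  let ?U = "\<lambda>q. - pCons 0 q - map_poly (deriv_op act) q"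
  let ?D = "map_poly (map_poly (deriv_op act))"
  let ?F = "op_subst lam_mu (\<lambda>y. [:[:y:]:])"
  note dadd = deriv_op_additive[OF m]
  have d0: "deriv_op act 0 = 0" by (rule additive.zero[OF dadd])
  have Dadd: "additive ?D" by (intro additive_map_poly dadd)
  have Fadd: "additive ?F" by (intro additive_op_subst additive_lam_mu additive_const_const)
  have F_pCons: "?F (pCons 0 q) = lam_mu (?F q)" for q
  proof -
    have "?F (pCons 0 q) = (\<Sum>i\<le>Suc (degree q). (lam_mu ^^ i) [:[:coeff (pCons 0 q) i:]:])"
      by (rule op_subst_eq_sum) (auto simp: additive_lam_mu degree_pCons_le)
    also have "\<dots> = (\<Sum>i\<le>degree q. lam_mu ((lam_mu ^^ i) [:[:coeff q i:]:]))"
      by (subst sum.atMost_Suc_shift) simp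
    also have "\<dots> = lam_mu (?F q)"
      by (simp add: op_subst_def additive.sum[OF additive_lam_mu])
    finally show ?thesis .
  qed
  have D_lam_mu: "?D (lam_mu q) = lam_mu (?D q)" for q
  proof -
    have "?D (lam q) = lam (?D q)"
      by (rule poly_eqI) (simp add: lam_def coeff_map_poly map_poly_pCons_0 d0)
    moreover have "?D (mu q) = mu (?D q)"
      by (simp add: mu_def map_poly_pCons_0)
    ultimately show ?thesis
      by (simp add: lam_mu_def additive.add[OF Dadd])
  qed
  have D_pow: "?D ((lam_mu ^^ i) q) = (lam_mu ^^ i) (?D q)" for i q
    by (induction i) (simp_all add: D_lam_mu)
  have D_const: "?D [:[:x:]:] = [:[:deriv_op act x:]:]" for x
    by (cases "x = 0") (simp_all add: d0 map_poly_pCons)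
  have F_deriv: "?F (map_poly (deriv_op act) q) = ?D (?F q)" for q
  proof -
    have "?F (map_poly (deriv_op act) q) =
        (\<Sum>i\<le>degree q. (lam_mu ^^ i) [:[:coeff (map_poly (deriv_op act) q) i:]:])"
      by (rule op_subst_eq_sum) (simp_all add: additive_lam_mu map_poly_degree_leq)
    also have "\<dots> = (\<Sum>i\<le>degree q. ?D ((lam_mu ^^ i) [:[:coeff q i:]:]))"
      by (simp only: D_pow coeff_map_poly[of "deriv_op act", OF d0] D_const)
    also have "\<dots> = ?D (?F q)"
      by (simp add: op_subst_def additive.sum[OF Dadd])
    finally show ?thesis .
  qed
  have F_U: "?F (?U q) = neg_lam_mu act (?F q)" for q
    by (simp only: additive.diff[OF Fadd] additive.minus[OF Fadd] F_pCons F_deriv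
        neg_lam_mu_def lam_mu_def) (simp add: algebra_simps)
  have F_const: "?F [:x:] = [:[:x:]:]" for x
    by (simp add: op_subst_def)
  have F_U_pow: "?F ((?U ^^ i) [:x:]) = (neg_lam_mu act ^^ i) [:[:x:]:]" for i x
    by (induction i) (simp_all only: funpow.simps o_apply id_apply F_U F_const)
  have "?F (op_subst ?U (\<lambda>x. [:x:]) p) = (\<Sum>i\<le>degree p. ?F ((?U ^^ i) [:coeff p i:]))"
    unfolding op_subst_def[of ?U] by (rule additive.sum[OF Fadd])
  also have "\<dots> = op_subst (neg_lam_mu act) (\<lambda>y. [:[:y:]:]) p"
    by (simp only: F_U_pow op_subst_def[of "neg_lam_mu act"])
  finally show ?thesis .
qed

lemma right_nest_neg_lam_mu:
  assumes m: "module act" and skew: "\<And>a b. f a b = - swap_prod act f a b"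
    and "additive T"
  shows "right_nest f (neg_lam_mu act) g T c a b = - left_nest f lam_mu g T a b c"
proof -
  have "op_subst lam_mu (\<lambda>y. [:[:y:]:]) (f x c) =
      - op_subst (neg_lam_mu act) (\<lambda>y. [:[:y:]:]) (f c x)" for x
    by (subst skew)
       (simp del: minus_pCons add: swap_prod_def op_subst_lam_mu_swap[OF m]
         additive.minus[OF additive_op_subst[OF additive_lam_mu additive_const_const]])
  then show ?thesis
    by (simp add: right_nest_def left_nest_def op_subst_def sum_negf
        additive.minus[OF additive_funpow[OF \<open>additive T\<close>]])
qed

section \<open>Generators of deformations are cocycles\<close>

lemma bilinear_prod_additive:
  assumes "bilinear_prod act f"
  shows "additive (f a)" "additive (\<lambda>x. f x b)"
  using assms unfolding bilinear_prod_def additive_def Vector_Spaces.linear_def module_hom_def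
    module_hom_axioms_def by blast+

text \<open>
  The conditions of a \<open>2\<close>-\<open>\<lambda>\<close>-bracket are linear, so they pass from \<open>f\<close> and \<open>f + u\<close> to \<open>u\<close>.
\<close>

lemma lambda_bracket2_of_sum:
  assumes "module act" "bilinear_prod act u" "lambda_bracket2 act f" "lambda_bracket2 act (f + u)"
  shows "lambda_bracket2 act u"
proof -
  have "u (deriv_op act a) b = - pCons 0 (u a b)"
    "u a (deriv_op act b) = map_poly (deriv_op act) (u a b) + pCons 0 (u a b)" for a b
  proof -
    have u: "u a' b' = (f + u) a' b' - f a' b'" for a' b' by simp
    have left: "f (deriv_op act a) b = - pCons 0 (f a b)"
        "(f + u) (deriv_op act a) b = - pCons 0 ((f + u) a b)"
      and right: "f a (deriv_op act b) = map_poly (deriv_op act) (f a b) + pCons 0 (f a b)"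
        "(f + u) a (deriv_op act b) =
          map_poly (deriv_op act) ((f + u) a b) + pCons 0 ((f + u) a b)"
      using assms(3,4) unfolding lambda_bracket2_def by blast+
    show "u (deriv_op act a) b = - pCons 0 (u a b)"
      unfolding u[of "deriv_op act a"] left by simp
    show "u a (deriv_op act b) = map_poly (deriv_op act) (u a b) + pCons 0 (u a b)"
      unfolding u[of a "deriv_op act b"] right
      by (simp add: additive.add[OF additive_map_poly[OF deriv_op_additive[OF assms(1)]]]
          algebra_simps)
  qed
  then show ?thesis using assms(2) by (simp add: lambda_bracket2_def)
qed

lemma deformation_generators_in_C2:
  assumes P: "nc_poisson_conformal_algebra act mul brk"
    and gen: "generates_linear_deformation act mul brk \<pi> \<omega>"
  shows "\<omega> \<in> C20 act" "\<pi> \<in> C02 act"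
proof -
  interpret nc_poisson_conformal_algebra act mul brk by fact
  have m: "module act" by (rule mul.module_axioms)
  have bil: "bilinear_prod act \<pi>" "bilinear_prod act \<omega>"
    and P1: "nc_poisson_conformal_algebra act (mul + \<pi>) (brk + \<omega>)"
    using gen deform_prod_at_small_int(1)[OF m]
    by (auto simp: generates_linear_deformation_def dest: spec[of _ 1])
  interpret P1: nc_poisson_conformal_algebra act "mul + \<pi>" "brk + \<omega>" by (rule P1)
  show "\<pi> \<in> C02 act"
    unfolding C02_def
    using lambda_bracket2_of_sum[OF m bil(1) mul.lambda_bracket2 P1.mul.lambda_bracket2] by simp
  have "\<omega> a b = - swap_prod act \<omega> a b" for a b
    using P1.skew[of a b] skew[of a b] additive.add[OF additive_swap_prod[OF m], of brk \<omega> a b]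
    by simp
  then show "\<omega> \<in> C20 act"
    unfolding C20_def
    using lambda_bracket2_of_sum[OF m bil(2) brk.lambda_bracket2 P1.brk.lambda_bracket2] by blast
qed

text \<open>
  Subtracting an axiom of \<open>P\<^sub>t\<close> at \<open>t = -1\<close> from the same axiom at \<open>t = 1\<close> cancels the constant and
  quadratic coefficients.  What remains is twice the linear coefficient: associativity yields the
  Hochschild component, the Leibniz rule the mixed one, and the Jacobi identity the
  Chevalley-Eilenberg one.
\<close>

lemma deformation_generators_cocycle:
  assumes P: "nc_poisson_conformal_algebra act mul brk"
    and gen: "generates_linear_deformation act mul brk \<pi> \<omega>"
  shows "(\<omega>, \<pi>) \<in> Z2_FGV act mul brk"
proof -
  interpret nc_poisson_conformal_algebra act mul brk by fact
  have m: "module act" by (rule mul.module_axioms)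
  note C2 = deformation_generators_in_C2[OF P gen]
  have bil: "bilinear_prod act mul" "bilinear_prod act brk"
      "bilinear_prod act \<pi>" "bilinear_prod act \<omega>"
    using mul.lambda_bracket2 brk.lambda_bracket2 gen
    by (simp_all only: lambda_bracket2_def generates_linear_deformation_def)
  have P1: "nc_poisson_conformal_algebra act (mul + \<pi>) (brk + \<omega>)"
    and P2: "nc_poisson_conformal_algebra act (mul - \<pi>) (brk - \<omega>)"
    using gen[unfolded generates_linear_deformation_def, THEN conjunct2, THEN conjunct2, rule_format]
    by (simp_all only: flip: deform_prod_at_small_int(1,2)[OF m])
  interpret P1: nc_poisson_conformal_algebra act "mul + \<pi>" "brk + \<omega>" by (rule P1)
  interpret P2: nc_poisson_conformal_algebra act "mul - \<pi>" "brk - \<omega>" by (rule P2)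
  note right = right_nest_first_order[OF _ _ bilinear_prod_additive(1) bilinear_prod_additive(1)]
  note left = left_nest_first_order[OF _ _ bilinear_prod_additive(2) bilinear_prod_additive(2)]
  note adds = additive_lam additive_mu additive_lam_mu
  have halve: "x = y" if "x + x = y + y" for x y :: "'a poly poly"
  proof -
    have "(x - y) + (x - y) = 0" using that by (simp add: algebra_simps)
    then have "x - y = 0" by (rule double_poly_poly_eq_zero_imp_zero[OF m])
    then show ?thesis by simp
  qed
  have halve_sum: "x = y + z"
    if "x1 - x2 = x + x" "y1 - y2 = y + y" "z1 - z2 = z + z" "x1 = y1 + z1" "x2 = y2 + z2"
    for x y z x1 x2 y1 y2 z1 z2 :: "'a poly poly"
  proof (rule halve)
    have "x + x = (y1 - y2) + (z1 - z2)" using that(1,4,5) by (simp add: algebra_simps)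
    then show "x + x = y + z + (y + z)" unfolding that(2,3) by (simp add: algebra_simps)
  qed
  have assoc_linear: "right_nest mul lam \<pi> mu a b c + right_nest \<pi> lam mul mu a b c =
      left_nest mul lam_mu \<pi> lam a b c + left_nest \<pi> lam_mu mul lam a b c" for a b c
    by (rule halve)
       (simp only: right[OF adds(1,2) bil(1,3), symmetric] left[OF adds(3,1) bil(1,3), symmetric]
         P1.assoc P2.assoc)
  have leibniz_linear: "right_nest brk lam \<pi> mu a b c + right_nest \<omega> lam mul mu a b c =
      (left_nest mul lam_mu \<omega> lam a b c + left_nest \<pi> lam_mu brk lam a b c) +
      (right_nest mul mu \<omega> lam b a c + right_nest \<pi> mu brk lam b a c)" for a b c
    by (rule halve_sum[OF right[OF adds(1,2) bil(2,4)] left[OF adds(3,1) bil(1,3)]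
          right[OF adds(2,1) bil(1,3)] P1.leibniz P2.leibniz])
  have jacobi_linear: "right_nest brk lam \<omega> mu a b c + right_nest \<omega> lam brk mu a b c =
      (left_nest brk lam_mu \<omega> lam a b c + left_nest \<omega> lam_mu brk lam a b c) +
      (right_nest brk mu \<omega> lam b a c + right_nest \<omega> mu brk lam b a c)" for a b c
    by (rule halve_sum[OF right[OF adds(1,2) bil(2,4)] left[OF adds(3,1) bil(2,4)]
          right[OF adds(2,1) bil(2,4)] P1.jacobi P2.jacobi])
  have \<omega>_skew: "\<omega> a b = - swap_prod act \<omega> a b" for a b
    using C2(1) by (auto simp: C20_def)
  have "d_CE act brk \<omega> a b c = 0" for a b c
    using jacobi_linear[of a b c]
    by (simp add: d_CE_def right_nest_neg_lam_mu[where f = brk, OF m skew additive_lam]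
        right_nest_neg_lam_mu[where f = \<omega>, OF m \<omega>_skew additive_lam] algebra_simps)
  moreover have "(d02_CE brk \<pi> - d11_H mul \<omega>) a b c = 0" for a b c
    using leibniz_linear[of a b c] by (simp add: d02_CE_def d11_H_def algebra_simps)
  moreover have "d02_H mul \<pi> a b c = 0" for a b c
    using assoc_linear[of a b c] by (simp add: d02_H_def algebra_simps)
  ultimately have "d2_FGV act mul brk (\<omega>, \<pi>) = 0"
    by (simp add: d2_FGV_def fun_eq_iff zero_prod_def)
  then show ?thesis
    using C2 by (simp add: Z2_FGV_def C2_FGV_def)
qed

section \<open>Equivalences are coboundaries\<close>

text \<open>
  The homomorphism identity for \<open>Id + tN\<close> reads \<open>A t + B t\<^sup>2 + C t\<^sup>3 = 0\<close>, where \<open>A = 0\<close> is the claim;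
  the constant terms on both sides are \<open>f a b\<close>.  The values at \<open>1\<close> and \<open>-1\<close> give \<open>2B = 0\<close> and
  \<open>A = -C\<close>, and then the value at \<open>2\<close> is \<open>2A + 8C = 6C\<close>.
\<close>

lemma first_order_of_equivalence:
  fixes act :: "complex poly \<Rightarrow> 'p::ab_group_add \<Rightarrow> 'p"
  assumes m: "module act"
    and f: "bilinear_prod act f" and \<gamma>': "bilinear_prod act \<gamma>'" and N: "additive N"
    and hom: "\<And>t::real. map_poly (\<lambda>x. x + cscale act (of_real t) (N x)) (deform_prod act f \<gamma> t a b) =
      deform_prod act f \<gamma>' t (a + cscale act (of_real t) (N a)) (b + cscale act (of_real t) (N b))"
  shows "\<gamma> a b - \<gamma>' a b = f a (N b) - map_poly N (f a b) + f (N a) b"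
proof -
  note add = bilinear_prod_additive[OF f] bilinear_prod_additive[OF \<gamma>']
  note dist = add[THEN additive.add] add[THEN additive.diff] add[THEN additive.minus]
  note M = additive_map_poly[OF N]
  note N0 = additive.zero[OF N]
  have map_id_add: "map_poly (\<lambda>x. x + N x) q = q + map_poly N q"
    "map_poly (\<lambda>x. x - N x) q = q - map_poly N q"
    "map_poly (\<lambda>x. x + (N x + N x)) q = q + (map_poly N q + map_poly N q)" for q
    by (rule poly_eqI; simp add: coeff_map_poly N0)+
  note simps = deform_prod_at_small_int[OF m] cscale_of_small_int[OF m] map_id_add dist
    additive.add[OF M] additive.diff[OF M]
  define A where "A = \<gamma> a b + map_poly N (f a b) - f a (N b) - f (N a) b - \<gamma>' a b"
  define B where "B = map_poly N (\<gamma> a b) - f (N a) (N b) - \<gamma>' a (N b) - \<gamma>' (N a) b"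
  define C where "C = - \<gamma>' (N a) (N b)"
  have "(A + C) + B = 0"
    using hom[of 1] by (simp add: simps A_def B_def C_def algebra_simps)
  moreover have A_C: "A + C = B"
    using hom[of "- 1"] by (simp add: simps A_def B_def C_def algebra_simps)
  ultimately have "B + B = 0" by (simp only:)
  then have B: "B = 0" by (rule double_poly_eq_zero_imp_zero[OF m])
  then have AC: "A = - C" using A_C by (simp add: eq_neg_iff_add_eq_0)
  have "A + A + (B + B + B + B) + (C + C + C + C + C + C + C + C) = 0"
    using hom[of 2] by (simp add: simps A_def B_def C_def algebra_simps)
  then have "(C + C + C) + (C + C + C) = 0"
    unfolding AC B by (simp add: algebra_simps)
  then have "C + C + C = 0" by (rule double_poly_eq_zero_imp_zero[OF m])
  then have "C = 0" by (rule triple_poly_eq_zero_imp_zero[OF m])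
  then have "A = 0" using AC by simp
  then show ?thesis by (simp add: A_def algebra_simps)
qed

theorem theorem5p14:
  fixes act :: "complex poly \<Rightarrow> 'p::ab_group_add \<Rightarrow> 'p"
    and mul brk \<pi> \<omega> \<pi>' \<omega>' :: "'p \<Rightarrow> 'p \<Rightarrow> 'p poly"
  assumes "nc_poisson_conformal_algebra act mul brk"
    and "generates_linear_deformation act mul brk \<pi> \<omega>"
    and "generates_linear_deformation act mul brk \<pi>' \<omega>'"
    and "equivalent_deformations act mul brk \<pi> \<omega> \<pi>' \<omega>'"
  shows "\<exists>X \<in> H2_FGV act mul brk. (\<omega>, \<pi>) \<in> X \<and> (\<omega>', \<pi>') \<in> X"
proof -
  interpret nc_poisson_conformal_algebra act mul brk by (rule assms(1))
  have m: "module act" by (rule mul.module_axioms)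
  note cocycle = deformation_generators_cocycle[OF assms(1,2)]
  note cocycle' = deformation_generators_cocycle[OF assms(1,3)]
  have bil: "bilinear_prod act mul" "bilinear_prod act brk"
      "bilinear_prod act \<pi>'" "bilinear_prod act \<omega>'"
    using mul.lambda_bracket2 brk.lambda_bracket2 assms(3)
    by (auto simp: lambda_bracket2_def generates_linear_deformation_def)
  obtain N where N: "Vector_Spaces.linear (cscale act) (cscale act) N"
    and hom: "\<And>t::real. npca_hom
          act (deform_prod act mul \<pi> t) (deform_prod act brk \<omega> t)
          act (deform_prod act mul \<pi>' t) (deform_prod act brk \<omega>' t)
          (\<lambda>x. x + cscale act (of_real t) (N x))"
    using assms(4) by (auto simp: equivalent_deformations_def)
  have Nadd: "additive N"
    using N by (auto simp: additive_def Vector_Spaces.linear_def module_hom_def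
        module_hom_axioms_def)
  have "N (deriv_op act x) = deriv_op act (N x)" for x
    using hom[of 1]
    by (simp add: npca_hom_def cscale_of_small_int[OF m]
        additive.add[OF deriv_op_additive[OF m]])
  then have N_C1: "N \<in> C1_FGV act"
    using module_hom_of_linear_commuting[OF m N] by (simp add: C1_FGV_def C10_def)
  have "(\<omega>, \<pi>) - (\<omega>', \<pi>') = d1_FGV act mul brk N"
  proof -
    have "\<pi> a b - \<pi>' a b = mul a (N b) - map_poly N (mul a b) + mul (N a) b" for a b
      using hom by (intro first_order_of_equivalence[OF m bil(1,3) Nadd]) (simp add: npca_hom_def)
    moreover have
      "\<omega> a b - \<omega>' a b = brk a (N b) - map_poly N (brk a b) + brk (N a) b" for a b
      using hom by (intro first_order_of_equivalence[OF m bil(2,4) Nadd]) (simp add: npca_hom_def)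
    then have
      "\<omega> a b - \<omega>' a b = brk a (N b) - swap_prod act brk (N a) b - map_poly N (brk a b)" for a b
      using skew[of "N a" b] by simp
    ultimately show ?thesis
      by (simp add: d1_FGV_def fun_eq_iff)
  qed
  then have diff: "(\<omega>, \<pi>) - (\<omega>', \<pi>') \<in> B2_FGV act mul brk"
    using N_C1 by (simp add: B2_FGV_def)
  \<comment> \<open>That \<open>(\<omega>, \<pi>)\<close> lies in its own class amounts to \<open>0\<close> being a coboundary.\<close>
  have "0 = d1_FGV act mul brk (\<lambda>x. 0)"
  proof -
    have "brk a 0 = 0" "mul a 0 = 0" "mul 0 b = 0" "brk 0 b = 0" for a b
      using bil(1,2)[THEN bilinear_prod_additive(1), THEN additive.zero]
        bil(1,2)[THEN bilinear_prod_additive(2), THEN additive.zero] by auto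
    moreover have "map_poly (\<lambda>x. 0) q = (0 :: 'p poly)" for q :: "'p poly"
      by (rule poly_eqI) (simp add: coeff_map_poly)
    ultimately show ?thesis
      using skew[of 0] by (simp add: d1_FGV_def zero_prod_def fun_eq_iff)
  qed
  moreover have "(\<lambda>x. 0) \<in> C1_FGV act"
    unfolding C1_FGV_def C10_def mem_Collect_eq
    by unfold_locales simp_all
  ultimately have zero: "0 \<in> B2_FGV act mul brk"
    unfolding B2_FGV_def by blast
  let ?R = "{(x, y). x \<in> Z2_FGV act mul brk \<and> y \<in> Z2_FGV act mul brk \<and>
    x - y \<in> B2_FGV act mul brk}"
  have "?R `` {(\<omega>, \<pi>)} \<in> H2_FGV act mul brk"
    unfolding H2_FGV_def by (rule quotientI) (rule cocycle)
  moreover have "(\<omega>, \<pi>) \<in> ?R `` {(\<omega>, \<pi>)}"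
    using cocycle zero by simp
  moreover have "(\<omega>', \<pi>') \<in> ?R `` {(\<omega>, \<pi>)}"
    using cocycle cocycle' diff by simp
  ultimately show ?thesis by (intro bexI conjI)
qed

end
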